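(* For a commutative semigroup $X$ the following conditions are equivalent: (1) the semigroup $\upsilon(X)$ is commutative; (2) $\upsilon(X)$ is supercommutative; (3) the semigroups $\upsilon^\bullet(X)$ and $\beta(X)$ are commutative; (4) $\mathcal A*\mathcal B^\perp=\mathcal B^\perp*\mathcal A$ for any filters $\mathcal A,\mathcal B\in\varphi(X)$; (5) $\{a_nb_n\}_{n\in\omega}\cap\{b_na_{n+1}\}_{n\in\omega}\ne\emptyset$ for any sequences $(a_n)_{n\in\omega}$ and $(b_n)_{n\in\omega}$ in $X$.
   Context: $\omega=\{0,1,2,\dots\}$. An upfamily on a nonempty set $X$ is a nonempty family $\mathcal F$ of nonempty subsets of $X$ such that $F\in\mathcal F$ and $F\subset E\subset X$ imply $E\in\mathcal F$; $\upsilon(X)$ is the set of all upfamilies on $X$. A family $\mathcal G$ of nonempty subsets of $X$ generates the upfamily $\langle G:G\in\mathcal G\rangle=\{E\subset X:\exists G\in\mathcal G,\ G\subset E\}$. The transversal of $\mathcal F\in\upsilon(X)$ is $\mathcal F^\perp=\{E\subset X:\forall F\in\mathcal F,\ E\cap F\ne\emptyset\}\in\upsilon(X)$. An upfamily is finitely supported if it equals $\langle F_1,\dots,F_n\rangle$ for some (finitely many, at least one) nonempty finite sets $F_i\subset X$; $\upsilon^\bullet(X)$ is the set of finitely supported upfamilies. A filter is an upfamily closed under pairwise intersections; $\varphi(X)$ is the set of filters and $\beta(X)$ the set of ultrafilters (maximal filters) on $X$. If $X$ is a semigroup, put for $\mathcal A,\mathcal B\in\upsilon(X)$: $\mathcal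 A*\mathcal B=\langle\bigcup_{a\in A}aB_a: A\in\mathcal A,\ (B_a)_{a\in A}\in\mathcal B^A\rangle$ and $\mathcal A\circledast\mathcal B=\langle AB:A\in\mathcal A,\ B\in\mathcal B\rangle$, where $AB=\{ab:a\in A,b\in B\}$. The operation $*$ is associative and $\upsilon^\bullet(X)$, $\beta(X)$ are subsemigroups of $(\upsilon(X),* )$. A subsemigroup $S$ of $(\upsilon(X),* )$ is commutative if $\mathcal A*\mathcal B=\mathcal B*\mathcal A$ for all $\mathcal A,\mathcal B\in S$, and supercommutative if $\mathcal A*\mathcal B=\mathcal A\circledast\mathcal B=\mathcal B\circledast\mathcal A=\mathcal B*\mathcal A$ for all $\mathcal A,\mathcal B\in S$. *)

theory Defs
  imports Main "HOL-Library.Set_Algebras"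
begin

definition upfamilies :: "'a set set set" where
  "upfamilies = {\<F>. \<F> \<noteq> {} \<and> {} \<notin> \<F> \<and> (\<forall>F\<in>\<F>. \<forall>E. F \<subseteq> E \<longrightarrow> E \<in> \<F>)}"

definition generated :: "'a set set \<Rightarrow> 'a set set" where
  "generated \<G> = {E. \<exists>G\<in>\<G>. G \<subseteq> E}"

definition transversal :: "'a set set \<Rightarrow> 'a set set" where
  "transversal \<F> = {E. \<forall>F\<in>\<F>. E \<inter> F \<noteq> {}}"

definition finitely_supported :: "'a set set set" where
  "finitely_supported =
    {generated \<G> | \<G>. finite \<G> \<and> \<G> \<noteq> {} \<and> (\<forall>G\<in>\<G>. finite G \<and> G \<noteq> {})}"

(* Families of sets rather than the library type 'a filter: all of these are proper,
   since members of an upfamily are nonempty. *)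
definition filters :: "'a set set set" where
  "filters = {\<F> \<in> upfamilies. \<forall>E\<in>\<F>. \<forall>F\<in>\<F>. E \<inter> F \<in> \<F>}"

definition ultrafilters :: "'a set set set" where
  "ultrafilters = {\<F> \<in> filters. \<forall>\<G>\<in>filters. \<F> \<subseteq> \<G> \<longrightarrow> \<G> = \<F>}"

(* A family (B_a) indexed by A is a total function B, whose values outside A are irrelevant;
   a *o B a is the translate of the set B a by a. *)
definition up_mult :: "'a::semigroup_mult set set \<Rightarrow> 'a set set \<Rightarrow> 'a set set"
    (infixl "\<star>" 70) where
  "\<A> \<star> \<B> = generated {\<Union>a\<in>A. a *o B a | A B. A \<in> \<A> \<and> (\<forall>a\<in>A. B a \<in> \<B>)}"

(* A * B is the elementwise product of the sets A and B. *)
definition up_smult :: "'a::semigroup_mult set set \<Rightarrow> 'a set set \<Rightarrow> 'a set set"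
    (infixl "\<circledast>" 70) where
  "\<A> \<circledast> \<B> = generated {A * B | A B. A \<in> \<A> \<and> B \<in> \<B>}"

definition commutative :: "'a::semigroup_mult set set set \<Rightarrow> bool" where
  "commutative S \<longleftrightarrow> (\<forall>\<A>\<in>S. \<forall>\<B>\<in>S. \<A> \<star> \<B> = \<B> \<star> \<A>)"

definition supercommutative :: "'a::semigroup_mult set set set \<Rightarrow> bool" where
  "supercommutative S \<longleftrightarrow> (\<forall>\<A>\<in>S. \<forall>\<B>\<in>S.
     \<A> \<star> \<B> = \<A> \<circledast> \<B> \<and> \<A> \<circledast> \<B> = \<B> \<circledast> \<A> \<and> \<B> \<circledast> \<A> = \<B> \<star> \<A>)"

end

theory Submission
  imports Defs
begin

text \<open>
  Condition (5) forbids an infinite walk \<open>a\<^sub>0, b\<^sub>0, a\<^sub>1, b\<^sub>1, \<dots>\<close> whose consecutive products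
  lie alternately inside and outside a set \<open>U\<close>. If \<open>U \<in> \<A> \<star> \<B>\<close> contains no product
  \<open>A * B\<close>, such a walk can be built step by step, so (5) implies (2). Conversely, for the
  family of supersets of \<open>{a\<^sub>k | k \<in> K}\<close> and the family of sets meeting
  \<open>{b\<^sub>k | k \<in> K}\<close>, commutation forces some row \<open>b\<^sub>k * a\<^sub>j\<close> (\<open>j \<in> K\<close>) to stay inside
  \<open>U\<close> as soon as all \<open>a\<^sub>k * b\<^sub>k\<close> do. Taking \<open>K\<close> infinite shows that (4) implies (5). Taking
  \<open>K\<close> finite shows that there are no closed alternating walks; an infinite alternating walk
  must therefore satisfy \<open>a\<^sub>i * b\<^sub>j \<in> U \<longleftrightarrow> i \<le> j\<close>, and ultrafilters containing all tails
  of the two sequences do not commute.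
\<close>

section \<open>Upfamilies, filters and generated families\<close>

lemma upfamiliesI:
  assumes "\<F> \<noteq> {}" "{} \<notin> \<F>" "\<And>E F. F \<in> \<F> \<Longrightarrow> F \<subseteq> E \<Longrightarrow> E \<in> \<F>"
  shows "\<F> \<in> upfamilies"
  using assms unfolding upfamilies_def by blast

lemma upfamilies_mono:
  assumes "\<F> \<in> upfamilies" "F \<in> \<F>" "F \<subseteq> E"
  shows "E \<in> \<F>"
  using assms unfolding upfamilies_def by blast

lemma upfamilies_nonempty:
  assumes "\<F> \<in> upfamilies" "F \<in> \<F>"
  shows "F \<noteq> {}"
  using assms unfolding upfamilies_def by blast

lemma upfamilies_UNIV:
  assumes "\<F> \<in> upfamilies"
  shows "UNIV \<in> \<F>"
  using assms unfolding upfamilies_def by blast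

lemma filters_subset_upfamilies: "filters \<subseteq> upfamilies"
  unfolding filters_def by blast

lemma ultrafilters_subset_filters: "ultrafilters \<subseteq> filters"
  unfolding ultrafilters_def by blast

lemma filters_Int:
  assumes "\<F> \<in> filters" "E \<in> \<F>" "F \<in> \<F>"
  shows "E \<inter> F \<in> \<F>"
  using assms unfolding filters_def by blast

lemma filters_meet:
  assumes "\<F> \<in> filters" "E \<in> \<F>" "F \<in> \<F>"
  shows "E \<inter> F \<noteq> {}"
  using assms filters_Int filters_subset_upfamilies upfamilies_nonempty by blast

lemma generated_in_upfamilies:
  assumes "\<G> \<noteq> {}" "{} \<notin> \<G>"
  shows "generated \<G> \<in> upfamilies"
proof (rule upfamiliesI)
  show "generated \<G> \<noteq> {}" "{} \<notin> generated \<G>"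
    using assms by (auto simp: generated_def)
  show "E \<in> generated \<G>" if "F \<in> generated \<G>" "F \<subseteq> E" for E F
    using that unfolding generated_def mem_Collect_eq by (meson subset_trans)
qed

lemma finitely_supported_subset_upfamilies: "finitely_supported \<subseteq> upfamilies"
  unfolding finitely_supported_def by (auto intro!: generated_in_upfamilies)

lemma transversal_in_upfamilies:
  assumes "\<F> \<in> upfamilies"
  shows "transversal \<F> \<in> upfamilies"
proof (rule upfamiliesI)
  have "UNIV \<in> transversal \<F>"
    using upfamilies_nonempty[OF assms] by (auto simp: transversal_def)
  then show "transversal \<F> \<noteq> {}" by blast
  show "{} \<notin> transversal \<F>"
    using upfamilies_UNIV[OF assms] unfolding transversal_def by blast
  show "E \<in> transversal \<F>" if "F \<in> transversal \<F>" "F \<subseteq> E" for E F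
    using that unfolding transversal_def by blast
qed

lemma generated_in_filters:
  assumes "\<G> \<noteq> {}" "{} \<notin> \<G>" "\<And>E F. E \<in> \<G> \<Longrightarrow> F \<in> \<G> \<Longrightarrow> E \<inter> F \<in> \<G>"
  shows "generated \<G> \<in> filters"
proof -
  have "E \<inter> F \<in> generated \<G>" if "E \<in> generated \<G>" "F \<in> generated \<G>" for E F
  proof -
    obtain E' F' where "E' \<in> \<G>" "E' \<subseteq> E" "F' \<in> \<G>" "F' \<subseteq> F"
      using \<open>E \<in> generated \<G>\<close> \<open>F \<in> generated \<G>\<close> unfolding generated_def by blast
    then have "E' \<inter> F' \<in> \<G>" "E' \<inter> F' \<subseteq> E \<inter> F"
      using assms(3) by auto
    then show ?thesis unfolding generated_def by blast
  qed
  then show ?thesis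
    using generated_in_upfamilies[OF assms(1,2)] unfolding filters_def by blast
qed

text \<open>Meeting every superset of the image of \<open>K\<close> under \<open>b\<close> means
  meeting that image, hence containing some \<open>b k\<close>. This gives the transversals of
  condition (4) the shape used in \<open>commuting_row\<close>.\<close>

lemma transversal_generated_singleton:
  "transversal (generated {b ` K}) = generated ((\<lambda>k. {b k}) ` K)"
  unfolding transversal_def generated_def by auto

section \<open>Existence of ultrafilters\<close>

lemma Union_chain_in_filters:
  assumes "C \<noteq> {}" "C \<subseteq> filters" "subset.chain \<S> C"
  shows "\<Union>C \<in> filters"
proof -
  have up: "\<F> \<in> upfamilies" if "\<F> \<in> C" for \<F>
    using that assms(2) filters_subset_upfamilies by blast
  have "E \<inter> F \<in> \<Union>C" if "E \<in> \<Union>C" "F \<in> \<Union>C" for E F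
  proof -
    obtain \<E> \<F> where "\<E> \<in> C" "E \<in> \<E>" "\<F> \<in> C" "F \<in> \<F>"
      using \<open>E \<in> \<Union>C\<close> \<open>F \<in> \<Union>C\<close> by blast
    moreover from this have "\<E> \<subseteq> \<F> \<or> \<F> \<subseteq> \<E>"
      using assms(3) unfolding subset_chain_def by blast
    ultimately obtain \<G> where "\<G> \<in> C" "E \<in> \<G>" "F \<in> \<G>"
      by blast
    then show ?thesis
      using assms(2) filters_Int by blast
  qed
  moreover have "\<Union>C \<in> upfamilies"
  proof (rule upfamiliesI)
    show "\<Union>C \<noteq> {}"
      using assms(1) up upfamilies_UNIV by blast
    show "{} \<notin> \<Union>C"
      using up upfamilies_nonempty by blast
    show "E \<in> \<Union>C" if "F \<in> \<Union>C" "F \<subseteq> E" for E F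
      using that up upfamilies_mono by (meson UnionE UnionI)
  qed
  ultimately show ?thesis
    unfolding filters_def by blast
qed

lemma ex_ultrafilter_extending:
  assumes "\<F> \<in> filters"
  obtains \<U> where "\<U> \<in> ultrafilters" "\<F> \<subseteq> \<U>"
proof -
  let ?S = "{\<G> \<in> filters. \<F> \<subseteq> \<G>}"
  have "\<exists>\<U>\<in>?S. \<forall>\<G>\<in>?S. \<U> \<subseteq> \<G> \<longrightarrow> \<G> = \<U>"
  proof (rule subset_Zorn_nonempty)
    show "?S \<noteq> {}" using assms by blast
    fix C assume "C \<noteq> {}" and C: "subset.chain ?S C"
    then have "C \<subseteq> ?S"
      unfolding subset_chain_def by blast
    then show "\<Union>C \<in> ?S"
      using \<open>C \<noteq> {}\<close> Union_chain_in_filters[OF _ _ C] by blast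
  qed
  then obtain \<U> where \<U>: "\<U> \<in> ?S" and max: "\<forall>\<G>\<in>?S. \<U> \<subseteq> \<G> \<longrightarrow> \<G> = \<U>" ..
  \<comment> \<open>Any filter above \<open>\<U>\<close> also contains \<open>\<F>\<close>, so
    maximality within \<open>?S\<close> is maximality among all filters.\<close>
  have "\<U> \<in> ultrafilters"
    unfolding ultrafilters_def mem_Collect_eq
  proof (intro conjI ballI impI)
    fix \<G> assume "\<G> \<in> filters" "\<U> \<subseteq> \<G>"
    with \<U> have "\<G> \<in> ?S" by auto
    then show "\<G> = \<U>" using max \<open>\<U> \<subseteq> \<G>\<close> by simp
  qed (use \<U> in simp)
  then show thesis using \<U> that by simp
qed

lemma ex_ultrafilter_tails:
  fixes a :: "nat \<Rightarrow> 'a"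
  obtains \<U> where "\<U> \<in> ultrafilters" "\<And>n. a ` {n..} \<in> \<U>"
proof -
  \<comment> \<open>Each member of \<open>?\<G>\<close> is the principal filter of a tail of
    \<open>a\<close>; the filters increase with \<open>n\<close>, so \<open>?\<F>\<close> is the
    filter generated by all tails.\<close>
  let ?\<G> = "range (\<lambda>n. {E. a ` {n..} \<subseteq> E})"
  let ?\<F> = "\<Union>?\<G>"
  have "?\<F> \<in> filters"
  proof -
    have "E \<inter> F \<in> ?\<F>" if EF: "E \<in> ?\<F>" "F \<in> ?\<F>" for E F
    proof -
      obtain m n where "a ` {m..} \<subseteq> E" "a ` {n..} \<subseteq> F"
        using EF by auto
      then have "a ` {max m n..} \<subseteq> E \<inter> F" by auto
      then show ?thesis by blast
    qed
    moreover have "?\<F> \<in> upfamilies"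
      by (rule upfamiliesI) auto
    ultimately show ?thesis unfolding filters_def by blast
  qed
  then obtain \<U> where "\<U> \<in> ultrafilters" "?\<F> \<subseteq> \<U>"
    by (rule ex_ultrafilter_extending)
  then show thesis
    by (intro that) auto
qed

section \<open>Membership in the two products\<close>

lemma up_mult_iff:
  assumes "\<B> \<in> upfamilies"
  shows "U \<in> \<A> \<star> \<B> \<longleftrightarrow> (\<exists>A\<in>\<A>. \<forall>a\<in>A. {b. a * b \<in> U} \<in> \<B>)"
proof
  assume "U \<in> \<A> \<star> \<B>"
  then obtain A B where A: "A \<in> \<A>" "\<forall>a\<in>A. B a \<in> \<B>" and U: "(\<Union>a\<in>A. a *o B a) \<subseteq> U"
    unfolding up_mult_def generated_def by blast
  \<comment> \<open>This set is the largest possible choice of \<open>B a\<close>, so it can replace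
    any other choice.\<close>
  have "{b. a * b \<in> U} \<in> \<B>" if "a \<in> A" for a
  proof (rule upfamilies_mono[OF assms])
    show "B a \<in> \<B>" using A that by blast
    show "B a \<subseteq> {b. a * b \<in> U}" using U that by (auto simp: elt_set_times_def)
  qed
  then show "\<exists>A\<in>\<A>. \<forall>a\<in>A. {b. a * b \<in> U} \<in> \<B>" using A by blast
next
  assume "\<exists>A\<in>\<A>. \<forall>a\<in>A. {b. a * b \<in> U} \<in> \<B>"
  then obtain A where A: "A \<in> \<A>" "\<forall>a\<in>A. {b. a * b \<in> U} \<in> \<B>" by blast
  moreover have "(\<Union>a\<in>A. a *o {b. a * b \<in> U}) \<subseteq> U"
    by (auto simp: elt_set_times_def)
  ultimately show "U \<in> \<A> \<star> \<B>"
    unfolding up_mult_def generated_def mem_Collect_eq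
    by (intro bexI[of _ "\<Union>a\<in>A. a *o {b. a * b \<in> U}"])
      (auto intro!: exI[of _ A] exI[of _ "\<lambda>a. {b. a * b \<in> U}"])
qed

lemma up_smult_iff: "U \<in> \<A> \<circledast> \<B> \<longleftrightarrow> (\<exists>A\<in>\<A>. \<exists>B\<in>\<B>. \<forall>a\<in>A. \<forall>b\<in>B. a * b \<in> U)"
proof -
  have *: "A * B \<subseteq> U \<longleftrightarrow> (\<forall>a\<in>A. \<forall>b\<in>B. a * b \<in> U)" for A B
    by (auto elim!: set_times_elim)
  show ?thesis
    unfolding up_smult_def generated_def *[symmetric] by blast
qed

lemma up_smult_commute: "\<A> \<circledast> \<B> = \<B> \<circledast> (\<A> :: 'a::ab_semigroup_mult set set)"
proof -
  have "U \<in> \<B> \<circledast> \<A>" if "U \<in> \<A> \<circledast> \<B>" for U and \<A> \<B> :: "'a set set"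
    using that unfolding up_smult_iff by (metis mult.commute)
  then show ?thesis by blast
qed

text \<open>A single \<open>B\<close> serves as a constant family \<open>B a\<close>.\<close>

lemma up_smult_subset_up_mult:
  assumes "\<B> \<in> upfamilies"
  shows "\<A> \<circledast> \<B> \<subseteq> \<A> \<star> \<B>"
proof
  fix U assume "U \<in> \<A> \<circledast> \<B>"
  then obtain A B where AB: "A \<in> \<A>" "B \<in> \<B>" "\<forall>a\<in>A. \<forall>b\<in>B. a * b \<in> U"
    unfolding up_smult_iff by blast
  then have "{b. a * b \<in> U} \<in> \<B>" if "a \<in> A" for a
    using that by (intro upfamilies_mono[OF assms \<open>B \<in> \<B>\<close>]) blast
  then show "U \<in> \<A> \<star> \<B>"
    unfolding up_mult_iff[OF assms] using AB(1) by blast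
qed

section \<open>From the sequence condition to supercommutativity\<close>

lemma up_mult_eq_up_smult:
  fixes \<A> \<B> :: "'a::ab_semigroup_mult set set"
  assumes seq: "\<And>a b :: nat \<Rightarrow> 'a. range (\<lambda>n. a n * b n) \<inter> range (\<lambda>n. b n * a (Suc n)) \<noteq> {}"
    and \<A>: "\<A> \<in> upfamilies" and \<B>: "\<B> \<in> upfamilies"
  shows "\<A> \<star> \<B> = \<A> \<circledast> \<B>"
proof
  show "\<A> \<star> \<B> \<subseteq> \<A> \<circledast> \<B>"
  proof (rule subsetI, rule ccontr)
    fix U assume not: "U \<notin> \<A> \<circledast> \<B>"
    assume "U \<in> \<A> \<star> \<B>"
    then obtain A where A: "A \<in> \<A>" and A_B: "\<forall>a\<in>A. {b. a * b \<in> U} \<in> \<B>"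
      unfolding up_mult_iff[OF \<B>] ..
    \<comment> \<open>Otherwise \<open>A\<close> and the set of all \<open>b\<close> with
      \<open>a * b \<in> U\<close> would witness
      \<open>U \<in> \<A> \<circledast> \<B>\<close>.\<close>
    have "\<exists>b a'. a' \<in> A \<and> a * b \<in> U \<and> b * a' \<notin> U" if "a \<in> A" for a
    proof -
      have "\<not> (\<forall>a'\<in>A. \<forall>b\<in>{b. a * b \<in> U}. a' * b \<in> U)"
        using not A A_B that unfolding up_smult_iff by blast
      then show ?thesis by (metis mem_Collect_eq mult.commute)
    qed
    then obtain f g where
      fg: "\<And>a. a \<in> A \<Longrightarrow> g a \<in> A \<and> a * f a \<in> U \<and> f a * g a \<notin> U"
      by metis
    obtain a0 where "a0 \<in> A"
      using upfamilies_nonempty[OF \<A> A] by blast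
    \<comment> \<open>The next step depends only on the current point of \<open>A\<close>, so
      iterating \<open>g\<close> produces the walk, with \<open>f (a n)\<close> as its second
      sequence.\<close>
    define a where "a n = (g ^^ n) a0" for n
    have "a n \<in> A" for n
      by (induction n) (use \<open>a0 \<in> A\<close> fg in \<open>auto simp: a_def\<close>)
    then have "a n * f (a n) \<in> U" "f (a n) * a (Suc n) \<notin> U" for n
      using fg[of "a n"] by (auto simp: a_def)
    then have "range (\<lambda>n. a n * f (a n)) \<subseteq> U" "range (\<lambda>n. f (a n) * a (Suc n)) \<subseteq> - U"
      by auto
    then show False
      using seq[of a "\<lambda>n. f (a n)"] by blast
  qed
qed (rule up_smult_subset_up_mult[OF \<B>])

section \<open>From commutation to the sequence condition\<close>

lemma commuting_row:
  fixes a b :: "'k \<Rightarrow> 'a::semigroup_mult" and K :: "'k set"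
  defines "\<A> \<equiv> generated {a ` K}" and "\<B> \<equiv> generated ((\<lambda>k. {b k}) ` K)"
  assumes "K \<noteq> {}" and comm: "\<A> \<star> \<B> = \<B> \<star> \<A>" and U: "\<And>k. k \<in> K \<Longrightarrow> a k * b k \<in> U"
  obtains k where "k \<in> K" "\<And>j. j \<in> K \<Longrightarrow> b k * a j \<in> U"
proof -
  have up: "\<A> \<in> upfamilies" "\<B> \<in> upfamilies"
    unfolding \<A>_def \<B>_def using \<open>K \<noteq> {}\<close> by (auto intro!: generated_in_upfamilies)
  have "U \<in> \<A> \<star> \<B>"
    unfolding up_mult_iff[OF up(2)]
    \<comment> \<open>For the point \<open>a k\<close>, the generator \<open>{b k}\<close> already
      lies in the required set.\<close>
    by (rule bexI[of _ "a ` K"]) (use U in \<open>auto simp: \<A>_def \<B>_def generated_def\<close>)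
  then have "U \<in> \<B> \<star> \<A>"
    using comm by simp
  \<comment> \<open>A witness from \<open>\<B>\<close> contains some \<open>b k\<close>, and the set
    of \<open>x\<close> with \<open>b k * x \<in> U\<close>, being in \<open>\<A>\<close>, contains
    every \<open>a j\<close>.\<close>
  then show thesis
    unfolding up_mult_iff[OF up(1)]
    by (auto simp: \<A>_def \<B>_def generated_def intro: that)
qed

text \<open>Finiteness of \<open>K\<close> makes both families finitely supported, and the row from
  \<open>commuting_row\<close> stays in \<open>U\<close> at \<open>a (s k)\<close> too. The map
  \<open>s\<close> prescribes which \<open>a\<close> follows each \<open>b k\<close>, so a walk in
  \<open>K\<close> can be closed up at will.\<close>

lemma no_closed_alternating_walk:
  fixes a b :: "'k \<Rightarrow> 'a::semigroup_mult"
  assumes comm: "commutative (finitely_supported :: 'a set set set)"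
    and "finite K" "K \<noteq> {}" "\<And>k. k \<in> K \<Longrightarrow> s k \<in> K" "\<And>k. k \<in> K \<Longrightarrow> a k * b k \<in> U"
  shows "\<exists>k\<in>K. b k * a (s k) \<in> U"
proof -
  have "generated {a ` K} \<in> finitely_supported"
    using assms(2,3) by (auto simp: finitely_supported_def intro!: exI[of _ "{a ` K}"])
  moreover have "generated ((\<lambda>k. {b k}) ` K) \<in> finitely_supported"
    using assms(2,3)
    by (auto simp: finitely_supported_def intro!: exI[of _ "(\<lambda>k. {b k}) ` K"])
  ultimately have "generated {a ` K} \<star> generated ((\<lambda>k. {b k}) ` K)
      = generated ((\<lambda>k. {b k}) ` K) \<star> generated {a ` K}"
    using comm unfolding commutative_def by blast
  then obtain k where "k \<in> K" "\<And>j. j \<in> K \<Longrightarrow> b k * a j \<in> U"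
    using commuting_row[of K a b U] assms(3,5) by blast
  then show ?thesis
    using assms(4) by blast
qed

lemma alternating_walk_half_graph:
  fixes a b :: "nat \<Rightarrow> 'a::ab_semigroup_mult"
  assumes comm: "commutative (finitely_supported :: 'a set set set)"
    and U: "\<And>n. a n * b n \<in> U" and not_U: "\<And>n. b n * a (Suc n) \<notin> U"
  shows "a i * b j \<in> U \<longleftrightarrow> i \<le> j"
proof (cases "i \<le> j")
  case True
  \<comment> \<open>Follow the walk from \<open>a i\<close> to \<open>b j\<close> and return to
    \<open>a i\<close>. All other steps out of a \<open>b k\<close> leave \<open>U\<close>, so the
    returning product \<open>b j * a i\<close> lies in \<open>U\<close>.\<close>
  define s where "s k = (if k = j then i else Suc k)" for k
  have "\<exists>k\<in>{i..j}. b k * a (s k) \<in> U"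
    by (rule no_closed_alternating_walk[OF comm]) (use True U in \<open>auto simp: s_def\<close>)
  then show ?thesis
    using True not_U by (auto simp: s_def mult.commute split: if_splits)
next
  case False
  \<comment> \<open>If \<open>a i * b j\<close> were in \<open>U\<close>, the walk from
    \<open>a (Suc j)\<close> to \<open>a i\<close> could continue to \<open>b j\<close>, which takes
    the place of \<open>b i\<close>, and close with \<open>b j * a (Suc j)\<close>, outside
    \<open>U\<close>.\<close>
  define s where "s k = (if k = i then Suc j else Suc k)" for k
  have "a i * b j \<notin> U"
  proof
    assume "a i * b j \<in> U"
    then have "\<exists>k\<in>{Suc j..i}. (b(i := b j)) k * a (s k) \<in> U"
      by (intro no_closed_alternating_walk[OF comm]) (use False U in \<open>auto simp: s_def\<close>)
    then show False
      using not_U by (auto simp: s_def split: if_splits)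
  qed
  then show ?thesis using False by blast
qed

text \<open>Iterated limits disagree: each \<open>a i * b j\<close> is in \<open>U\<close> for all
  large \<open>j\<close>, but for fixed \<open>j\<close> it is outside \<open>U\<close> for all
  large \<open>i\<close>.\<close>

lemma half_graph_not_commuting:
  fixes a b :: "nat \<Rightarrow> 'a::ab_semigroup_mult"
  assumes half: "\<And>i j. a i * b j \<in> U \<longleftrightarrow> i \<le> j"
  shows "\<not> commutative (ultrafilters :: 'a set set set)"
proof
  assume comm: "commutative (ultrafilters :: 'a set set set)"
  obtain \<A> where \<A>: "\<A> \<in> ultrafilters" "\<And>n. a ` {n..} \<in> \<A>"
    using ex_ultrafilter_tails[of a] by metis
  obtain \<B> where \<B>: "\<B> \<in> ultrafilters" "\<And>n. b ` {n..} \<in> \<B>"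
    using ex_ultrafilter_tails[of b] by metis
  have fil: "\<A> \<in> filters" "\<B> \<in> filters"
    using \<A>(1) \<B>(1) ultrafilters_subset_filters by auto
  then have up: "\<A> \<in> upfamilies" "\<B> \<in> upfamilies"
    using filters_subset_upfamilies by auto
  have "{y. a i * y \<in> U} \<in> \<B>" for i
    by (rule upfamilies_mono[OF up(2) \<B>(2)[of i]]) (use half in auto)
  then have "U \<in> \<A> \<star> \<B>"
    unfolding up_mult_iff[OF up(2)] using \<A>(2)[of 0] by blast
  then have "U \<in> \<B> \<star> \<A>"
    using comm \<A>(1) \<B>(1) unfolding commutative_def by blast
  then obtain B where B: "B \<in> \<B>" and B_\<A>: "\<forall>y\<in>B. {x. y * x \<in> U} \<in> \<A>"
    unfolding up_mult_iff[OF up(1)] ..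
  \<comment> \<open>The tail from 0 is the whole range of \<open>b\<close>, so \<open>B\<close> must
    meet it.\<close>
  obtain j where "b j \<in> B"
    using filters_meet[OF fil(2) B \<B>(2)[of 0]] by auto
  then have "{x. b j * x \<in> U} \<in> \<A>"
    using B_\<A> by simp
  \<comment> \<open>The tail from \<open>Suc j\<close> consists of the points whose products with
    \<open>b j\<close> should avoid \<open>U\<close>.\<close>
  then obtain i where "i \<ge> Suc j" "b j * a i \<in> U"
    using filters_meet[OF fil(1) _ \<A>(2)[of "Suc j"]] by auto
  then show False
    using half[of i j] by (simp add: mult.commute)
qed

lemma sequences_meet_if_commutative:
  fixes a b :: "nat \<Rightarrow> 'a::ab_semigroup_mult"
  assumes "commutative (finitely_supported :: 'a set set set)"
    and "commutative (ultrafilters :: 'a set set set)"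
  shows "range (\<lambda>n. a n * b n) \<inter> range (\<lambda>n. b n * a (Suc n)) \<noteq> {}"
proof
  assume "range (\<lambda>n. a n * b n) \<inter> range (\<lambda>n. b n * a (Suc n)) = {}"
  \<comment> \<open>Here \<open>U\<close> is the range of the products \<open>a n * b n\<close>;
    disjointness puts every \<open>b n * a (Suc n)\<close> outside it.\<close>
  then have "a i * b j \<in> range (\<lambda>n. a n * b n) \<longleftrightarrow> i \<le> j" for i j
    by (intro alternating_walk_half_graph[OF assms(1)]) blast+
  then show False
    using half_graph_not_commuting assms(2) by blast
qed

lemma sequences_meet_if_transversal_commute:
  fixes a b :: "nat \<Rightarrow> 'a::semigroup_mult"
  assumes "\<And>\<A> \<B> :: 'a set set. \<A> \<in> filters \<Longrightarrow> \<B> \<in> filters \<Longrightarrow>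
    \<A> \<star> transversal \<B> = transversal \<B> \<star> \<A>"
  shows "range (\<lambda>n. a n * b n) \<inter> range (\<lambda>n. b n * a (Suc n)) \<noteq> {}"
proof -
  have "generated {range c} \<in> filters" for c :: "nat \<Rightarrow> 'a"
    by (rule generated_in_filters) auto
  then have "generated {range a} \<star> generated (range (\<lambda>k. {b k}))
      = generated (range (\<lambda>k. {b k})) \<star> generated {range a}"
    using assms by (metis transversal_generated_singleton)
  then obtain k where "\<And>j. b k * a j \<in> range (\<lambda>n. a n * b n)"
    using commuting_row[of UNIV a b "range (\<lambda>n. a n * b n)"] by auto
  \<comment> \<open>Taking \<open>j = Suc k\<close> gives a common element.\<close>
  then show ?thesis by blast
qed

theorem theorem7p2:
  shows "(commutative (upfamilies :: 'a::ab_semigroup_mult set set set)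
            \<longleftrightarrow> supercommutative (upfamilies :: 'a set set set))
       \<and> (supercommutative (upfamilies :: 'a set set set)
            \<longleftrightarrow> commutative (finitely_supported :: 'a set set set)
                \<and> commutative (ultrafilters :: 'a set set set))
       \<and> (commutative (finitely_supported :: 'a set set set)
                \<and> commutative (ultrafilters :: 'a set set set)
            \<longleftrightarrow> (\<forall>\<A>\<in>(filters :: 'a set set set). \<forall>\<B>\<in>(filters :: 'a set set set).
                  \<A> \<star> transversal \<B> = transversal \<B> \<star> \<A>))
       \<and> ((\<forall>\<A>\<in>(filters :: 'a set set set). \<forall>\<B>\<in>(filters :: 'a set set set).
                  \<A> \<star> transversal \<B> = transversal \<B> \<star> \<A>)
            \<longleftrightarrow> (\<forall>a b :: nat \<Rightarrow> 'a.
                  range (\<lambda>n. a n * b n) \<inter> range (\<lambda>n. b n * a (Suc n)) \<noteq> {}))"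
proof -
  let ?C1 = "commutative (upfamilies :: 'a set set set)"
  let ?C2 = "supercommutative (upfamilies :: 'a set set set)"
  let ?C3 = "commutative (finitely_supported :: 'a set set set)
      \<and> commutative (ultrafilters :: 'a set set set)"
  let ?C4 = "\<forall>\<A>\<in>(filters :: 'a set set set). \<forall>\<B>\<in>(filters :: 'a set set set).
      \<A> \<star> transversal \<B> = transversal \<B> \<star> \<A>"
  let ?C5 = "\<forall>a b :: nat \<Rightarrow> 'a. range (\<lambda>n. a n * b n) \<inter> range (\<lambda>n. b n * a (Suc n)) \<noteq> {}"
  \<comment> \<open>Both orders of \<open>\<star>\<close> reduce to the symmetric product
    \<open>\<circledast>\<close>. The implications below form two cycles through \<open>?C5\<close>,
    \<open>?C2\<close> and \<open>?C1\<close>, one returning via \<open>?C3\<close>, the other via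
    \<open>?C4\<close>.\<close>
  have "?C5 \<Longrightarrow> ?C2"
    unfolding supercommutative_def
    by (simp add: up_mult_eq_up_smult) (metis up_smult_commute)
  moreover have "?C2 \<Longrightarrow> ?C1"
    unfolding supercommutative_def commutative_def by metis
  moreover have "?C1 \<Longrightarrow> ?C3"
    using finitely_supported_subset_upfamilies ultrafilters_subset_filters
      filters_subset_upfamilies unfolding commutative_def by blast
  moreover have "?C1 \<Longrightarrow> ?C4"
    using filters_subset_upfamilies transversal_in_upfamilies unfolding commutative_def by blast
  moreover have "?C3 \<Longrightarrow> ?C5"
    using sequences_meet_if_commutative by blast
  moreover have "?C4 \<Longrightarrow> ?C5"
    by (intro allI sequences_meet_if_transversal_commute) simp
  ultimately show ?thesis by argo
qed

end
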